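(* Let $(X_i)_{i\ge 1}$ be independent (not necessarily identically distributed) nonnegative absolutely continuous random variables, where $X_i$ has a probability density function $f_i$ that is continuous on $\mathbb{R}_+=[0,\infty)$ (and $f_i=0$ on $(-\infty,0)$) and cumulative distribution function $F_i(x)=\int_0^x f_i(x')\,dx'$ for $x\ge 0$. For $n\ge 1$ let $Y_n=\sum_{i=1}^n X_i$, $Z_n=\max_{1\le i\le n}X_i$, and let $G_n(y,z)=P(Y_n\le y,\ Z_n\le z)$. Then for all integers $n\ge 2$ and all $(y,z)\in\mathbb{R}_+^2$, $$G_n(y,z)=\int_0^z G_{n-1}(y-x,z)\,f_n(x)\,dx=\int_0^{\min(y,z)}G_{n-1}(y-x,z)\,f_n(x)\,dx,$$ with initial condition $$G_1(y,z)=F_1(\min(y,z)),\qquad \forall (y,z)\in\mathbb{R}_+^2.$$ In addition, $G_n$ is continuous on $\mathbb{R}_+^2$ for all $n\ge 1$.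
   Context: $G_n(y,z)=0$ whenever $y<0$ or $z<0$ (the variables are nonnegative and have no atoms). *)

theory Defs
  imports "HOL-Probability.Probability"
begin

definition Ysum :: "(nat \<Rightarrow> 'a \<Rightarrow> real) \<Rightarrow> nat \<Rightarrow> 'a \<Rightarrow> real" where
  "Ysum X n \<omega> = (\<Sum>i=1..n. X i \<omega>)"

text \<open>Only meaningful for \<open>n \<ge> 1\<close>: \<^const>\<open>Max\<close> of the empty set is unspecified.\<close>

definition Zmax :: "(nat \<Rightarrow> 'a \<Rightarrow> real) \<Rightarrow> nat \<Rightarrow> 'a \<Rightarrow> real" where
  "Zmax X n \<omega> = Max ((\<lambda>i. X i \<omega>) ` {1..n})"

text \<open>The arguments range over all reals: the recursion evaluates \<open>G\<close> at \<open>y - x\<close>,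
  which may be negative.\<close>

definition G :: "'a measure \<Rightarrow> (nat \<Rightarrow> 'a \<Rightarrow> real) \<Rightarrow> nat \<Rightarrow> real \<Rightarrow> real \<Rightarrow> real" where
  "G M X n y z = measure M {\<omega> \<in> space M. Ysum X n \<omega> \<le> y \<and> Zmax X n \<omega> \<le> z}"

end

theory Submission
  imports Defs
begin

text \<open>Condition on \<open>X\<^sub>n\<close>, which is independent of \<open>(X\<^sub>1, \<dots>, X\<^sub>n\<^sub>-\<^sub>1)\<close>: Fubini turns the probability
  of an event in the pair into the integral of the probabilities of its slices against \<open>f\<^sub>n\<close>.
  The slice at \<open>x\<close> of the event \<open>Y\<^sub>n \<le> y\<close>, \<open>Z\<^sub>n \<le> z\<close> is empty for \<open>x > z\<close>, null for \<open>x > y\<close>, and has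
  probability \<open>G\<^sub>n\<^sub>-\<^sub>1 (y - x, z)\<close> otherwise. The same formula shows that \<open>Y\<^sub>n\<close> has no atoms; neither
  has \<open>Z\<^sub>n\<close>, so continuity of \<open>G\<^sub>n\<close> follows by dominated convergence of the indicators.\<close>

text \<open>Independence is phrased as a product law because \<^const>\<open>prob_space.indep_var\<close> forces both
  variables to take values in the same type.\<close>

lemma (in prob_space) has_bochner_integral_prob_slice:
  fixes g :: "real \<Rightarrow> real"
  assumes S[measurable]: "S \<in> measurable M N"
    and joint: "distr M (N \<Otimes>\<^sub>M borel) (\<lambda>\<omega>. (S \<omega>, T \<omega>)) = distr M N S \<Otimes>\<^sub>M distr M borel T"
    and T: "distributed M lborel T g"
    and g: "\<And>x. 0 \<le> g x"
    and A: "A \<in> sets (N \<Otimes>\<^sub>M borel)"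
  shows "has_bochner_integral lborel (\<lambda>x. prob {\<omega> \<in> space M. (S \<omega>, x) \<in> A} * g x)
           (prob {\<omega> \<in> space M. (S \<omega>, T \<omega>) \<in> A})"
proof -
  have T'[measurable]: "T \<in> borel_measurable M"
    using distributed_measurable[OF T] by simp
  note A[measurable]
  have gm[measurable]: "g \<in> borel_measurable borel"
    using distributed_real_measurable[OF _ T] g by simp
  interpret S: prob_space "distr M N S" by (rule prob_space_distr) simp
  interpret T: prob_space "distr M borel T" by (rule prob_space_distr) simp
  interpret ST: pair_prob_space "distr M N S" "distr M borel T" ..
  have dT: "distr M borel T = density lborel (\<lambda>x. ennreal (g x))"
    using distributed_distr_eq_density[OF T] by (simp cong: distr_cong)
  have slice: "emeasure (distr M N S) ((\<lambda>s. (s, x)) -` A) = ennreal (prob {\<omega> \<in> space M. (S \<omega>, x) \<in> A})"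
    for x
  proof -
    have "(\<lambda>s. (s, x)) -` A \<in> sets N"
      using sets_Pair2[OF A] .
    then show ?thesis
      by (subst emeasure_distr) (auto simp: emeasure_eq_measure intro!: arg_cong[where f=prob])
  qed
  \<comment> \<open>Slice measures of a product-measurable set depend measurably on the point;
    \<open>slice\<close> carries this from \<open>emeasure\<close> to \<open>prob\<close>.\<close>
  have [measurable]: "(\<lambda>x. prob {\<omega> \<in> space M. (S \<omega>, x) \<in> A}) \<in> borel_measurable borel"
  proof -
    have "A \<in> sets (distr M N S \<Otimes>\<^sub>M distr M borel T)"
      using A by (simp cong: sets_pair_measure_cong)
    from ST.measurable_emeasure_Pair2[OF this]
    have "(\<lambda>x. ennreal (prob {\<omega> \<in> space M. (S \<omega>, x) \<in> A})) \<in> borel_measurable borel"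
      by (simp add: slice)
    from measurable_compose[OF this borel_measurable_enn2real] show ?thesis
      by simp
  qed
  have "ennreal (prob {\<omega> \<in> space M. (S \<omega>, T \<omega>) \<in> A})
      = emeasure (distr M (N \<Otimes>\<^sub>M borel) (\<lambda>\<omega>. (S \<omega>, T \<omega>))) A"
    by (subst emeasure_distr) (auto simp: emeasure_eq_measure intro!: arg_cong[where f=prob])
  also have "\<dots> = emeasure (distr M N S \<Otimes>\<^sub>M distr M borel T) A"
    by (simp only: joint)
  also have "\<dots> = (\<integral>\<^sup>+ x. emeasure (distr M N S) ((\<lambda>s. (s, x)) -` A) \<partial>distr M borel T)"
    using A by (intro ST.emeasure_pair_measure_alt2) (simp cong: sets_pair_measure_cong)
  also have "\<dots> = (\<integral>\<^sup>+ x. ennreal (prob {\<omega> \<in> space M. (S \<omega>, x) \<in> A} * g x) \<partial>lborel)"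
    unfolding slice dT
    by (subst nn_integral_density) (auto simp: ennreal_mult g mult.commute)
  \<comment> \<open>The nonnegative integral equals \<open>ennreal\<close> of a real number, so it
    is finite; integrability and the value are thus obtained together.\<close>
  finally show ?thesis
    by (intro has_bochner_integral_nn_integral) (auto simp: g)
qed

lemma Zmax_le_iff: "n \<ge> 1 \<Longrightarrow> Zmax X n \<omega> \<le> z \<longleftrightarrow> (\<forall>i\<in>{1..n}. X i \<omega> \<le> z)"
  unfolding Zmax_def by (subst Max_le_iff) auto

locale independent_densities = prob_space M
  for M :: "'a measure" +
  fixes X :: "nat \<Rightarrow> 'a \<Rightarrow> real" and f :: "nat \<Rightarrow> real \<Rightarrow> real"
  assumes indep: "indep_vars (\<lambda>_. borel) X {1..}"
    and f_nonneg: "i \<ge> 1 \<Longrightarrow> 0 \<le> f i x"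
    and density: "i \<ge> 1 \<Longrightarrow> distributed M lborel (X i) (\<lambda>x. ennreal (f i x))"
begin

section \<open>Measurability and independence of an initial block from the next variable\<close>

lemma measurable_X: "i \<ge> 1 \<Longrightarrow> X i \<in> borel_measurable M"
  using indep by (auto simp: indep_vars_def)

lemma measurable_Ysum [measurable]: "Ysum X n \<in> borel_measurable M"
  unfolding Ysum_def[abs_def] by (auto intro!: borel_measurable_sum measurable_X)

lemma measurable_density: "i \<ge> 1 \<Longrightarrow> f i \<in> borel_measurable borel"
  using distributed_real_measurable[OF _ density] f_nonneg by simp

lemma measurable_initial: "(\<lambda>\<omega>. \<lambda>i\<in>{1..n}. X i \<omega>) \<in> measurable M (PiM {1..n} (\<lambda>_. borel))"
  by (intro measurable_restrict measurable_X) simp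

text \<open>Supplies the hypothesis \<open>joint\<close> of the slice formula, with the whole tuple
  of the first \<open>n\<close> variables as \<open>S\<close>. Tuples over the disjoint index sets
  \<open>{1..n}\<close> and \<open>{Suc n}\<close> are independent, and the second tuple is then
  pushed forward to its only coordinate.\<close>

lemma joint_distr_initial_next:
  "distr M (PiM {1..n} (\<lambda>_. borel) \<Otimes>\<^sub>M borel) (\<lambda>\<omega>. (\<lambda>i\<in>{1..n}. X i \<omega>, X (Suc n) \<omega>)) =
   distr M (PiM {1..n} (\<lambda>_. borel)) (\<lambda>\<omega>. \<lambda>i\<in>{1..n}. X i \<omega>) \<Otimes>\<^sub>M distr M borel (X (Suc n))"
proof -
  let ?P = "\<lambda>I. PiM I (\<lambda>_. borel) :: (nat \<Rightarrow> real) measure" and ?R = "\<lambda>I \<omega>. \<lambda>i\<in>I. X i \<omega>"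
  note [measurable] = measurable_initial measurable_X[of "Suc n", simplified]
  have R[measurable]: "?R {Suc n} \<in> measurable M (?P {Suc n})"
    by (intro measurable_restrict) simp
  have last: "distr (distr M (?P {Suc n}) (?R {Suc n})) borel (\<lambda>v. v (Suc n)) = distr M borel (X (Suc n))"
    by (subst distr_distr) (auto simp: comp_def)
  have "indep_var (?P {1..n}) (?R {1..n}) (?P {Suc n}) (?R {Suc n})"
    using indep by (rule indep_var_restrict) auto
  then have pair: "distr M (?P {1..n}) (?R {1..n}) \<Otimes>\<^sub>M distr M (?P {Suc n}) (?R {Suc n}) =
      distr M (?P {1..n} \<Otimes>\<^sub>M ?P {Suc n}) (\<lambda>\<omega>. (?R {1..n} \<omega>, ?R {Suc n} \<omega>))"
    by (simp add: indep_var_distribution_eq)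
  have "distr M (?P {1..n} \<Otimes>\<^sub>M borel) (\<lambda>\<omega>. (?R {1..n} \<omega>, X (Suc n) \<omega>)) =
      distr (distr M (?P {1..n}) (?R {1..n}) \<Otimes>\<^sub>M distr M (?P {Suc n}) (?R {Suc n}))
      (?P {1..n} \<Otimes>\<^sub>M borel) (\<lambda>(v, w). (v, w (Suc n)))"
    unfolding pair by (subst distr_distr) (auto simp: comp_def simp del: One_nat_def)
  moreover have "distr (distr M (?P {1..n}) (?R {1..n})) (?P {1..n}) (\<lambda>v. v) \<Otimes>\<^sub>M
        distr (distr M (?P {Suc n}) (?R {Suc n})) borel (\<lambda>v. v (Suc n)) =
      distr (distr M (?P {1..n}) (?R {1..n}) \<Otimes>\<^sub>M distr M (?P {Suc n}) (?R {Suc n}))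
      (?P {1..n} \<Otimes>\<^sub>M borel) (\<lambda>(v, w). (v, w (Suc n)))"
    by (intro pair_measure_distr)
      (auto simp: last intro!: prob_space_imp_sigma_finite prob_space_distr)
  moreover have "distr (distr M (?P {1..n}) (?R {1..n})) (?P {1..n}) (\<lambda>v. v) = distr M (?P {1..n}) (?R {1..n})"
    by (subst distr_distr) (auto simp: comp_def simp del: One_nat_def)
  ultimately show ?thesis
    by (simp only: last)
qed

section \<open>Distribution functions and absence of atoms\<close>

lemma prob_X_le:
  assumes "i \<ge> 1"
  shows "prob {\<omega> \<in> space M. X i \<omega> \<le> a} = (\<integral>x. f i x * indicator {..a} x \<partial>lborel)"
proof -
  note [measurable] = measurable_X[OF assms]
  have "(\<integral>x. f i x * indicator {..a} x \<partial>lborel) = (\<integral>\<omega>. indicator {..a} (X i \<omega>) \<partial>M)"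
    using assms by (intro distributed_integral[OF density]) (auto simp: f_nonneg)
  also have "\<dots> = (\<integral>\<omega>. indicator {\<omega> \<in> space M. X i \<omega> \<le> a} \<omega> \<partial>M)"
    by (intro Bochner_Integration.integral_cong) (auto simp: indicator_def)
  finally show ?thesis
    by (simp add: Int_absorb2)
qed

lemma AE_X_neq:
  assumes "i \<ge> 1"
  shows "AE \<omega> in M. X i \<omega> \<noteq> a"
proof -
  have "AE x in lborel. x \<noteq> a"
    by (rule AE_lborel_singleton)
  then have "AE x in distr M lborel (X i). x \<noteq> a"
    unfolding distributed_distr_eq_density[OF density[OF assms]]
    using measurable_density[OF assms] by (subst AE_density) auto
  then show ?thesis
    using measurable_X[OF assms] by (subst (asm) AE_distr_iff) auto
qed

text \<open>Induction on \<open>n\<close> with \<open>a\<close> arbitrary, because the slice at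
  \<open>x\<close> of the event for \<open>Suc n\<close> is the event for \<open>n\<close> at the
  shifted level \<open>a - x\<close>.\<close>

lemma prob_Ysum_eq:
  assumes "n \<ge> 1"
  shows "prob {\<omega> \<in> space M. Ysum X n \<omega> = a} = 0"
  using assms
proof (induction n arbitrary: a rule: dec_induct)
  case base
  have "{\<omega> \<in> space M. Ysum X 1 \<omega> = a} \<in> events"
    by measurable
  moreover have "AE \<omega> in M. \<omega> \<notin> {\<omega> \<in> space M. Ysum X 1 \<omega> = a}"
    using AE_X_neq[of 1 a] by (auto simp: Ysum_def)
  ultimately show ?case
    by (simp only: prob_eq_0)
next
  case (step n)
  define A where "A = {p \<in> space (PiM {1..n} (\<lambda>_. borel) \<Otimes>\<^sub>M borel).
    (\<Sum>i=1..n. fst p i) + snd p = (a :: real)}"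
  have "A \<in> sets (PiM {1..n} (\<lambda>_. borel) \<Otimes>\<^sub>M borel)"
    unfolding A_def by measurable
  from has_bochner_integral_prob_slice[OF measurable_initial joint_distr_initial_next density f_nonneg this]
  have "prob {\<omega> \<in> space M. ((\<lambda>i\<in>{1..n}. X i \<omega>), X (Suc n) \<omega>) \<in> A}
    = (\<integral>x. prob {\<omega> \<in> space M. ((\<lambda>i\<in>{1..n}. X i \<omega>), x) \<in> A} * f (Suc n) x \<partial>lborel)"
    by (auto dest: has_bochner_integral_integral_eq)
  moreover have "((\<lambda>i\<in>{1..n}. X i \<omega>), x) \<in> A \<longleftrightarrow> Ysum X n \<omega> = a - x" for \<omega> x
    by (auto simp: A_def Ysum_def space_pair_measure space_PiM)
  moreover have "Ysum X n \<omega> = a - X (Suc n) \<omega> \<longleftrightarrow> Ysum X (Suc n) \<omega> = a" for \<omega>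
    by (auto simp: Ysum_def)
  \<comment> \<open>Every slice has probability 0 by the induction hypothesis, so the integrand
    vanishes identically.\<close>
  ultimately show ?case
    using step.IH by simp
qed

section \<open>Measurability, recursion and continuity of \<open>G\<close>\<close>

lemma events_G:
  assumes "n \<ge> 1"
  shows "{\<omega> \<in> space M. Ysum X n \<omega> \<le> y \<and> Zmax X n \<omega> \<le> z} \<in> events"
proof -
  have "{\<omega> \<in> space M. X i \<omega> \<le> z} \<in> events" if "i \<in> {1..n}" for i
    using that by (intro borel_measurable_le measurable_X) auto
  then have "{\<omega> \<in> space M. \<forall>i\<in>{1..n}. X i \<omega> \<le> z} \<in> events"
    by (intro sets.sets_Collect_finite_All') (use assms in auto)
  then show ?thesis
    unfolding Zmax_le_iff[OF assms] by (intro sets.sets_Collect_conj) simp_all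
qed

text \<open>The recursion for variables of either sign, hence the range \<open>{..z}\<close>;
  nonnegativity cuts it to \<open>{0..z}\<close> in the theorem.\<close>

lemma has_bochner_integral_G_Suc:
  assumes "n \<ge> 1"
  shows "has_bochner_integral lborel
           (\<lambda>x. indicator {..z} x * (G M X n (y - x) z * f (Suc n) x)) (G M X (Suc n) y z)"
proof -
  \<comment> \<open>The maximum is split into its coordinates: the conjunct
    \<open>snd p \<le> z\<close> turns into the indicator of \<open>{..z}\<close>, the others into
    the event behind \<open>G M X n (y - x) z\<close>.\<close>
  define A where "A = {p \<in> space (PiM {1..n} (\<lambda>_. borel) \<Otimes>\<^sub>M borel).
    (\<Sum>i=1..n. fst p i) + snd p \<le> y \<and> (\<forall>i\<in>{1..n}. fst p i \<le> z) \<and> snd p \<le> (z :: real)}"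
  have "A \<in> sets (PiM {1..n} (\<lambda>_. borel) \<Otimes>\<^sub>M borel)"
    unfolding A_def by measurable
  note has_bochner_integral_prob_slice[OF measurable_initial joint_distr_initial_next density f_nonneg this]
  moreover have A_iff: "((\<lambda>i\<in>{1..n}. X i \<omega>), x) \<in> A \<longleftrightarrow>
      Ysum X n \<omega> \<le> y - x \<and> Zmax X n \<omega> \<le> z \<and> x \<le> z" for \<omega> x
    by (auto simp: A_def Ysum_def Zmax_le_iff[OF assms] space_pair_measure space_PiM)
  moreover have "prob {\<omega> \<in> space M. Ysum X n \<omega> \<le> y - x \<and> Zmax X n \<omega> \<le> z \<and> x \<le> z} * f (Suc n) x
      = indicator {..z} x * (G M X n (y - x) z * f (Suc n) x)" for x
    by (auto simp: G_def indicator_def)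
  moreover have "Ysum X n \<omega> \<le> y - X (Suc n) \<omega> \<and> Zmax X n \<omega> \<le> z \<and> X (Suc n) \<omega> \<le> z \<longleftrightarrow>
      Ysum X (Suc n) \<omega> \<le> y \<and> Zmax X (Suc n) \<omega> \<le> z" for \<omega>
    using assms by (auto simp: Ysum_def Zmax_le_iff atLeastAtMostSuc_conv)
  ultimately show ?thesis
    by (simp only: G_def)
qed

lemma continuous_on_G:
  assumes "n \<ge> 1"
  shows "continuous_on UNIV (\<lambda>(y, z). G M X n y z)"
proof (rule continuous_on_sequentiallyI)
  fix u :: "nat \<Rightarrow> real \<times> real" and p
  assume u: "u \<longlonglongrightarrow> p"
  obtain y z where p: "p = (y, z)" by fastforce
  let ?E = "\<lambda>p. {\<omega> \<in> space M. Ysum X n \<omega> \<le> fst p \<and> Zmax X n \<omega> \<le> snd p}"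
  have E[measurable]: "?E q \<in> events" for q
    by (rule events_G[OF assms])
  have Y: "AE \<omega> in M. Ysum X n \<omega> \<noteq> y"
    using prob_Ysum_eq[OF assms, of y] by (subst (asm) prob_eq_0) auto
  \<comment> \<open>The maximum is attained by some \<open>X i\<close>, so it can equal
    \<open>z\<close> only on a finite union of null events.\<close>
  have Z: "AE \<omega> in M. Zmax X n \<omega> \<noteq> z"
  proof -
    have "AE \<omega> in M. \<forall>i\<in>{1..n}. X i \<omega> \<noteq> z"
      by (intro AE_finite_allI AE_X_neq) auto
    moreover have "Zmax X n \<omega> \<in> (\<lambda>i. X i \<omega>) ` {1..n}" for \<omega>
      unfolding Zmax_def using assms by (intro Max_in) auto
    ultimately show ?thesis
      by (auto elim!: eventually_mono) (metis imageE)
  qed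
  have "(\<lambda>k. \<integral>\<omega>. indicator (?E (u k)) \<omega> \<partial>M) \<longlonglongrightarrow> (\<integral>\<omega>. indicator (?E p) \<omega> \<partial>M :: real)"
  proof (rule integral_dominated_convergence[where w="\<lambda>_. 1"])
    show "AE \<omega> in M. (\<lambda>k. indicator (?E (u k)) \<omega> :: real) \<longlonglongrightarrow> indicator (?E p) \<omega>"
      using Y Z
    proof eventually_elim
      fix \<omega> assume ne: "Ysum X n \<omega> \<noteq> y" "Zmax X n \<omega> \<noteq> z"
      have lim: "(\<lambda>k. fst (u k)) \<longlonglongrightarrow> y" "(\<lambda>k. snd (u k)) \<longlonglongrightarrow> z"
        using u p by (auto intro: tendsto_eq_intros)
      \<comment> \<open>Away from the boundary \<open>Ysum X n \<omega> = y\<close> the comparison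
        is strict and survives a small change of the threshold, so the indicators are eventually
        constant.\<close>
      have "\<forall>\<^sub>F k in sequentially. (Ysum X n \<omega> \<le> fst (u k) \<longleftrightarrow> Ysum X n \<omega> \<le> y)"
        using order_tendstoD(1)[OF lim(1), of "Ysum X n \<omega>"] order_tendstoD(2)[OF lim(1), of "Ysum X n \<omega>"] ne(1)
        by (cases "Ysum X n \<omega> < y") (auto elim!: eventually_mono)
      moreover have "\<forall>\<^sub>F k in sequentially. (Zmax X n \<omega> \<le> snd (u k) \<longleftrightarrow> Zmax X n \<omega> \<le> z)"
        using order_tendstoD(1)[OF lim(2), of "Zmax X n \<omega>"] order_tendstoD(2)[OF lim(2), of "Zmax X n \<omega>"] ne(2)
        by (cases "Zmax X n \<omega> < z") (auto elim!: eventually_mono)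
      ultimately have "\<forall>\<^sub>F k in sequentially. (indicator (?E (u k)) \<omega> :: real) = indicator (?E p) \<omega>"
        by eventually_elim (simp add: p indicator_def)
      then show "(\<lambda>k. indicator (?E (u k)) \<omega> :: real) \<longlonglongrightarrow> indicator (?E p) \<omega>"
        by (rule tendsto_eventually)
    qed
  qed (use E in \<open>auto simp: indicator_def\<close>)
  then show "(\<lambda>k. case u k of (y, z) \<Rightarrow> G M X n y z) \<longlonglongrightarrow> (case p of (y, z) \<Rightarrow> G M X n y z)"
    by (simp add: G_def case_prod_beta Int_absorb2)
qed

end

theorem theorem2p1:
  fixes M :: "'a measure"
    and X :: "nat \<Rightarrow> 'a \<Rightarrow> real"
    and f :: "nat \<Rightarrow> real \<Rightarrow> real"
  assumes prob: "prob_space M"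
    and indep: "prob_space.indep_vars M (\<lambda>_. borel) X {1..}"
    and X_nonneg: "\<And>i. i \<ge> 1 \<Longrightarrow> AE \<omega> in M. 0 \<le> X i \<omega>"
    and f_nonneg: "\<And>i x. i \<ge> 1 \<Longrightarrow> 0 \<le> f i x"
    and density: "\<And>i. i \<ge> 1 \<Longrightarrow> distributed M lborel (X i) (\<lambda>x. ennreal (f i x))"
    and f_cont: "\<And>i. i \<ge> 1 \<Longrightarrow> continuous_on {0..} (f i)"
    and f_zero: "\<And>i x. i \<ge> 1 \<Longrightarrow> x < 0 \<Longrightarrow> f i x = 0"
  shows "(\<forall>n\<ge>2. \<forall>y\<ge>0. \<forall>z\<ge>0.
            set_integrable lborel {0..z} (\<lambda>x. G M X (n - 1) (y - x) z * f n x) \<and>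
            G M X n y z = (LBINT x:{0..z}. G M X (n - 1) (y - x) z * f n x) \<and>
            (LBINT x:{0..z}. G M X (n - 1) (y - x) z * f n x)
              = (LBINT x:{0..min y z}. G M X (n - 1) (y - x) z * f n x)) \<and>
         (\<forall>y\<ge>0. \<forall>z\<ge>0.
            G M X 1 y z = cdf (distr M borel (X 1)) (min y z) \<and>
            cdf (distr M borel (X 1)) (min y z) = (LBINT x:{0..min y z}. f 1 x)) \<and>
         (\<forall>n\<ge>1. continuous_on ({0..} \<times> {0..}) (\<lambda>(y, z). G M X n y z))"
proof -
  interpret independent_densities M X f
    by (intro independent_densities.intro independent_densities_axioms.intro assms)
  \<comment> \<open>Almost sure nonnegativity of the \<open>X i\<close> enters here: it makes the
    sum nonnegative, so no mass lies below a negative \<open>y\<close>.\<close>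
  have G_neg: "G M X n y z = 0" if "n \<ge> 1" "y < 0" for n y z
  proof -
    have "AE \<omega> in M. \<forall>i\<in>{1..n}. 0 \<le> X i \<omega>"
      by (intro AE_finite_allI X_nonneg) auto
    then have "AE \<omega> in M. \<not> (Ysum X n \<omega> \<le> y \<and> Zmax X n \<omega> \<le> z)"
    proof eventually_elim
      case (elim \<omega>)
      then have "0 \<le> Ysum X n \<omega>"
        unfolding Ysum_def by (intro sum_nonneg) auto
      with that show ?case by simp
    qed
    then show ?thesis
      using that(1) unfolding G_def by (subst prob_eq_0[OF events_G]) auto
  qed
  show ?thesis
  proof (intro conjI allI impI)
    fix n :: nat and y z :: real
    assume n: "2 \<le> n" and "0 \<le> y" "0 \<le> z"
    let ?h = "\<lambda>x. G M X (n - 1) (y - x) z * f n x"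
    \<comment> \<open>The density \<open>f n\<close> vanishes on the negative half-line, so the
      range shrinks to \<open>{0..z}\<close>.\<close>
    have "indicator {..z} x * ?h x = indicator {0..z} x *\<^sub>R ?h x" for x
      using n f_zero[of n x] by (auto simp: indicator_def)
    moreover have "has_bochner_integral lborel (\<lambda>x. indicator {..z} x * ?h x) (G M X n y z)"
      using has_bochner_integral_G_Suc[of "n - 1" z y] n by simp
    ultimately have *: "has_bochner_integral lborel (\<lambda>x. indicator {0..z} x *\<^sub>R ?h x) (G M X n y z)"
      by (simp only:)
    show "set_integrable lborel {0..z} ?h"
      using * unfolding set_integrable_def by (rule integrable.intros)
    show "G M X n y z = (LBINT x:{0..z}. ?h x)"
      using has_bochner_integral_integral_eq[OF *] unfolding set_lebesgue_integral_def by simp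
    \<comment> \<open>For \<open>y < x\<close> the argument \<open>y - x\<close> is negative and
      \<open>G_neg\<close> makes the integrand zero.\<close>
    show "(LBINT x:{0..z}. ?h x) = (LBINT x:{0..min y z}. ?h x)"
      using n G_neg[of "n - 1"] unfolding set_lebesgue_integral_def
      by (intro Bochner_Integration.integral_cong) (auto simp: indicator_def)
  next
    fix y z :: real
    have cdf: "cdf (distr M borel (X 1)) a = prob {\<omega> \<in> space M. X 1 \<omega> \<le> a}" for a
      unfolding cdf_def using measurable_X[of 1]
      by (subst measure_distr) (auto intro!: arg_cong[where f=prob])
    \<comment> \<open>For \<open>n = 1\<close> the sum and the maximum are both \<open>X 1\<close>,
      so the two bounds merge into \<open>min y z\<close>.\<close>
    show "G M X 1 y z = cdf (distr M borel (X 1)) (min y z)"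
      by (simp only: cdf) (simp add: G_def Ysum_def Zmax_def)
    show "cdf (distr M borel (X 1)) (min y z) = (LBINT x:{0..min y z}. f 1 x)"
      unfolding cdf prob_X_le[OF order_refl] set_lebesgue_integral_def
      using f_zero[of 1] by (intro Bochner_Integration.integral_cong) (auto simp: indicator_def)
  next
    fix n :: nat
    assume "1 \<le> n"
    from continuous_on_G[OF this] show "continuous_on ({0..} \<times> {0..}) (\<lambda>(y, z). G M X n y z)"
      by (rule continuous_on_subset) simp
  qed
qed

end
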